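(* Let $(C_{\mathcal{A}},h,\nabla)$ and $(C_{\mathcal{A}'},h',\nabla')$ be pseudo-Riemannian calculi, with $C_{\mathcal{A}}=(\mathcal{A},\mathfrak{g},M,\varphi)$ and $C_{\mathcal{A}'}=(\mathcal{A}',\mathfrak{g}',M',\varphi')$, and let $(\phi,\psi,\widehat{\psi}):(C_{\mathcal{A}},h)\to(C_{\mathcal{A}'},h')$ be an isometric embedding. Let $P:M\to M_\Psi$ and $\Pi:M\to M_\Psi^\perp$ be the projections with respect to $M=M_\Psi\oplus M_\Psi^\perp$, and for $\delta\in\mathfrak{g}'$, $m\in M_\Psi$, $\xi\in M_\Psi^\perp$ set $\alpha(\delta,m)=\Pi(\nabla_{\psi(\delta)}m)$ (second fundamental form) and $A_\xi(\delta)=-P(\nabla_{\psi(\delta)}\xi)$ (Weingarten map). If $\delta\in\mathfrak{g}'$, $m\in M_\Psi$ and $\xi\in M_\Psi^\perp$, then $$h\big(A_\xi(\delta),m\big)=h\big(\xi,\alpha(\delta,m)\big).$$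
   Context: Algebras are over $\mathbb{C}$. A real calculus is a tuple $C_{\mathcal{A}}=(\mathcal{A},\mathfrak{g},M,\varphi)$ where $\mathcal{A}$ is a unital $\ast$-algebra, $\mathfrak{g}\subseteq \mathrm{Der}(\mathcal{A})$ is a finite-dimensional real Lie algebra of derivations, $M$ is a right $\mathcal{A}$-module, and $\varphi:\mathfrak{g}\to M$ is an $\mathbb{R}$-linear map whose image generates $M$ as an $\mathcal{A}$-module. A metric on $M$ is a map $h:M\times M\to\mathcal{A}$, additive in the second argument, with $h(m_1,m_2a)=h(m_1,m_2)a$, $h(m_1,m_2)=h(m_2,m_1)^*$, and non-degenerate: $h(m_1,m_2)=0$ for all $m_2$ implies $m_1=0$. A real metric calculus $(C_{\mathcal{A}},h)$ is a real calculus with a metric $h$ on $M$ such that $h(\varphi(\partial_1),\varphi(\partial_2))^*=h(\varphi(\partial_1),\varphi(\partial_2))$ for all $\partial_1,\partial_2\in\mathfrak{g}$. An affine connection on $(M,\mathfrak{g})$ is a map $\nabla:\mathfrak{g}\times M\to M$, $(\partial,m)\mapsto\nabla_\partial m$, additive in $m$, $\mathbb{R}$-linear in $\partial$, with $\nabla_\partial(ma)=(\nabla_\partial m)a+m\,\partial(a)$. $(C_{\mathcal{A}},h,\nabla)$ is a pseudo-Riemannian calculus if for all $\partial,\partial_1,\partial_2\in\mathfrak{g}$, $m,n\in M$: $h(\nabla_\partial\varphi(\partial_1),\varphi(\partial_2))$ is hermitian (equal to its own $\ast$); $\partial(h(m,n))=h(\nabla_\partial m,n)+h(m,\nabla_\partial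 n)$; and $\nabla_{\partial_1}\varphi(\partial_2)-\nabla_{\partial_2}\varphi(\partial_1)-\varphi([\partial_1,\partial_2])=0$. A real calculus homomorphism $(\phi,\psi,\widehat{\psi}):C_{\mathcal{A}}\to C_{\mathcal{A}'}$ consists of: a $\ast$-algebra homomorphism $\phi:\mathcal{A}\to\mathcal{A}'$; a Lie algebra homomorphism $\psi:\mathfrak{g}'\to\mathfrak{g}$ with $\delta(\phi(a))=\phi(\psi(\delta)(a))$ for all $\delta\in\mathfrak{g}'$, $a\in\mathcal{A}$; and, setting $\Psi=\varphi\circ\psi$ and letting $M_\Psi$ be the submodule of $M$ generated by $\Psi(\mathfrak{g}')$, a map $\widehat{\psi}:M_\Psi\to M'$ that is additive, satisfies $\widehat{\psi}(ma)=\widehat{\psi}(m)\phi(a)$ for $m\in M_\Psi$, $a\in\mathcal{A}$, and $\widehat{\psi}(\Psi(\delta))=\varphi'(\delta)$ for all $\delta\in\mathfrak{g}'$. It is an isometric embedding $(C_{\mathcal{A}},h)\to(C_{\mathcal{A}'},h')$ of real metric calculi if $h'(\varphi'(\delta_1),\varphi'(\delta_2))=\phi(h(\Psi(\delta_1),\Psi(\delta_2)))$ for all $\delta_1,\delta_2\in\mathfrak{g}'$, $\phi$ is surjective, and $M=M_\Psi\oplus M_\Psi^\perp$, where $M_\Psi^\perp=\{m\in M: h(m,n)=0\text{ for all }n\in M_\Psi\}$. *)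

theory Defs
  imports Complex_Main "HOL-Library.Function_Algebras"
begin

section \<open>Unital star-algebras and derivations\<close>

text \<open>Building on \<^class>\<open>monoid_mult\<close> rather than \<^class>\<open>ring_1\<close> keeps the zero algebra.
  The underlying real vector space is the restriction of the complex one.\<close>

class unital_star_algebra = real_algebra + monoid_mult +
  fixes scaleC :: "complex \<Rightarrow> 'a \<Rightarrow> 'a" (infixr "*\<^sub>C" 75)
    and star :: "'a \<Rightarrow> 'a"
  assumes scaleR_scaleC: "scaleR r = scaleC (complex_of_real r)"
    and scaleC_add_right: "c *\<^sub>C (a + b) = c *\<^sub>C a + c *\<^sub>C b"
    and scaleC_add_left: "(c + d) *\<^sub>C a = c *\<^sub>C a + d *\<^sub>C a"
    and scaleC_scaleC: "c *\<^sub>C d *\<^sub>C a = (c * d) *\<^sub>C a"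
    and scaleC_one: "1 *\<^sub>C a = a"
    and mult_scaleC_left: "(c *\<^sub>C a) * b = c *\<^sub>C (a * b)"
    and mult_scaleC_right: "a * (c *\<^sub>C b) = c *\<^sub>C (a * b)"
    and star_star: "star (star a) = a"
    and star_add: "star (a + b) = star a + star b"
    and star_mult: "star (a * b) = star b * star a"
    and star_scaleC: "star (c *\<^sub>C a) = cnj c *\<^sub>C star a"

definition hermitian :: "'a::unital_star_algebra \<Rightarrow> bool" where
  "hermitian a \<longleftrightarrow> star a = a"

definition star_algebra_hom :: "('a::unital_star_algebra \<Rightarrow> 'b::unital_star_algebra) \<Rightarrow> bool" where
  "star_algebra_hom \<phi> \<longleftrightarrow>
    (\<forall>a b. \<phi> (a + b) = \<phi> a + \<phi> b) \<and>
    (\<forall>c a. \<phi> (c *\<^sub>C a) = c *\<^sub>C \<phi> a) \<and>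
    (\<forall>a b. \<phi> (a * b) = \<phi> a * \<phi> b) \<and>
    \<phi> 1 = 1 \<and>
    (\<forall>a. \<phi> (star a) = star (\<phi> a))"

definition derivation :: "('a::unital_star_algebra \<Rightarrow> 'a) \<Rightarrow> bool" where
  "derivation d \<longleftrightarrow>
    (\<forall>a b. d (a + b) = d a + d b) \<and>
    (\<forall>c a. d (c *\<^sub>C a) = c *\<^sub>C d a) \<and>
    (\<forall>a b. d (a * b) = d a * b + a * d b)"

definition bracket :: "('a::unital_star_algebra \<Rightarrow> 'a) \<Rightarrow> ('a \<Rightarrow> 'a) \<Rightarrow> ('a \<Rightarrow> 'a)" where
  "bracket d e = (\<lambda>a. d (e a) - e (d a))"

text \<open>Pointwise real vector space structure on functions; addition comes from
  \<^theory>\<open>HOL-Library.Function_Algebras\<close>.\<close>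

instantiation "fun" :: (type, real_vector) real_vector
begin

definition scaleR_fun_def: "r *\<^sub>R f = (\<lambda>x. r *\<^sub>R f x)"

instance
  by standard (auto simp: scaleR_fun_def fun_eq_iff scaleR_add_right scaleR_add_left)

end

text \<open>The span condition says that \<open>g\<close> is a real subspace of finite dimension.\<close>

definition derivation_lie_algebra :: "('a::unital_star_algebra \<Rightarrow> 'a) set \<Rightarrow> bool" where
  "derivation_lie_algebra g \<longleftrightarrow>
    (\<forall>d\<in>g. derivation d) \<and>
    (\<exists>B. finite B \<and> span B = g) \<and>
    (\<forall>d\<in>g. \<forall>e\<in>g. bracket d e \<in> g)"

definition lie_algebra_hom_on ::
  "('b::unital_star_algebra \<Rightarrow> 'b) set \<Rightarrow> ('a::unital_star_algebra \<Rightarrow> 'a) set \<Rightarrow>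
    (('b \<Rightarrow> 'b) \<Rightarrow> ('a \<Rightarrow> 'a)) \<Rightarrow> bool" where
  "lie_algebra_hom_on g' g \<psi> \<longleftrightarrow>
    (\<forall>d\<in>g'. \<psi> d \<in> g) \<and>
    (\<forall>d\<in>g'. \<forall>e\<in>g'. \<psi> (d + e) = \<psi> d + \<psi> e) \<and>
    (\<forall>r. \<forall>d\<in>g'. \<psi> (r *\<^sub>R d) = r *\<^sub>R \<psi> d) \<and>
    (\<forall>d\<in>g'. \<forall>e\<in>g'. \<psi> (bracket d e) = bracket (\<psi> d) (\<psi> e))"


section \<open>Right modules\<close>

locale right_module =
  fixes act :: "'m::ab_group_add \<Rightarrow> 'a::unital_star_algebra \<Rightarrow> 'm" (infixl "\<odot>" 70)
  assumes act_add_left: "(m + n) \<odot> a = m \<odot> a + n \<odot> a"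
    and act_add_right: "m \<odot> (a + b) = m \<odot> a + m \<odot> b"
    and act_mult: "m \<odot> (a * b) = (m \<odot> a) \<odot> b"
    and act_one: "m \<odot> 1 = m"

definition submodule ::
  "('m::ab_group_add \<Rightarrow> 'a::unital_star_algebra \<Rightarrow> 'm) \<Rightarrow> 'm set \<Rightarrow> bool" where
  "submodule act N \<longleftrightarrow>
    0 \<in> N \<and> (\<forall>m\<in>N. \<forall>n\<in>N. m + n \<in> N) \<and> (\<forall>m\<in>N. \<forall>a. act m a \<in> N)"

definition direct_sum :: "'m::ab_group_add set \<Rightarrow> 'm set \<Rightarrow> bool" where
  "direct_sum U V \<longleftrightarrow> (\<forall>m. \<exists>u\<in>U. \<exists>v\<in>V. m = u + v) \<and> U \<inter> V = {0}"

text \<open>Projection onto \<open>U\<close> along \<open>V\<close>; meaningful when the space is the direct sum of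
  the subgroups \<open>U\<close> and \<open>V\<close>.\<close>

definition projection :: "'m::ab_group_add set \<Rightarrow> 'm set \<Rightarrow> 'm \<Rightarrow> 'm" where
  "projection U V m = (THE u. u \<in> U \<and> (\<exists>v\<in>V. m = u + v))"


section \<open>Real calculi\<close>

text \<open>\<open>vphi\<close> is the map $\varphi$ from the Lie algebra to the module; \<open>\<phi>\<close> is reserved for
  homomorphisms of algebras. A real scalar \<open>r\<close> acts on the module as \<open>r *\<^sub>R 1\<close>.
  Maps on \<open>g\<close> are total functions whose values outside \<open>g\<close> are irrelevant.\<close>

locale real_calculus = right_module act
  for act :: "'m::ab_group_add \<Rightarrow> 'a::unital_star_algebra \<Rightarrow> 'm" (infixl "\<odot>" 70) +
  fixes g :: "('a \<Rightarrow> 'a) set"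
    and vphi :: "('a \<Rightarrow> 'a) \<Rightarrow> 'm"
  assumes lie_algebra: "derivation_lie_algebra g"
    and vphi_add: "d \<in> g \<Longrightarrow> e \<in> g \<Longrightarrow> vphi (d + e) = vphi d + vphi e"
    and vphi_scaleR: "d \<in> g \<Longrightarrow> vphi (r *\<^sub>R d) = vphi d \<odot> (r *\<^sub>R 1)"
    and vphi_generates: "submodule act hull (vphi ` g) = UNIV"

locale real_metric_calculus = real_calculus act g vphi
  for act :: "'m::ab_group_add \<Rightarrow> 'a::unital_star_algebra \<Rightarrow> 'm" (infixl "\<odot>" 70)
    and g vphi +
  fixes h :: "'m \<Rightarrow> 'm \<Rightarrow> 'a"
  assumes h_add: "h m (n + p) = h m n + h m p"
    and h_act: "h m (n \<odot> a) = h m n * a"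
    and h_star: "h m n = star (h n m)"
    and h_nondegenerate: "(\<forall>n. h m n = 0) \<Longrightarrow> m = 0"
    and h_vphi_hermitian: "d \<in> g \<Longrightarrow> e \<in> g \<Longrightarrow> hermitian (h (vphi d) (vphi e))"

locale affine_connection = right_module act
  for act :: "'m::ab_group_add \<Rightarrow> 'a::unital_star_algebra \<Rightarrow> 'm" (infixl "\<odot>" 70) +
  fixes g :: "('a \<Rightarrow> 'a) set"
    and nabla :: "('a \<Rightarrow> 'a) \<Rightarrow> 'm \<Rightarrow> 'm"
  assumes nabla_add: "d \<in> g \<Longrightarrow> nabla d (m + n) = nabla d m + nabla d n"
    and nabla_add_derivation:
      "d \<in> g \<Longrightarrow> e \<in> g \<Longrightarrow> nabla (d + e) m = nabla d m + nabla e m"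
    and nabla_scaleR: "d \<in> g \<Longrightarrow> nabla (r *\<^sub>R d) m = nabla d m \<odot> (r *\<^sub>R 1)"
    and nabla_act: "d \<in> g \<Longrightarrow> nabla d (m \<odot> a) = nabla d m \<odot> a + m \<odot> d a"

locale pseudo_riemannian_calculus =
  real_metric_calculus act g vphi h + affine_connection act g nabla
  for act :: "'m::ab_group_add \<Rightarrow> 'a::unital_star_algebra \<Rightarrow> 'm" (infixl "\<odot>" 70)
    and g vphi h nabla +
  assumes nabla_hermitian:
      "d \<in> g \<Longrightarrow> d1 \<in> g \<Longrightarrow> d2 \<in> g \<Longrightarrow> hermitian (h (nabla d (vphi d1)) (vphi d2))"
    and metric_compatible: "d \<in> g \<Longrightarrow> d (h m n) = h (nabla d m) n + h m (nabla d n)"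
    and torsion_free: "d1 \<in> g \<Longrightarrow> d2 \<in> g \<Longrightarrow>
      nabla d1 (vphi d2) - nabla d2 (vphi d1) - vphi (bracket d1 d2) = 0"


section \<open>Homomorphisms and isometric embeddings\<close>

text \<open>The submodule $M_\Psi$ generated by the image of $\Psi = \varphi \circ \psi$.\<close>

definition M_Psi ::
  "('m::ab_group_add \<Rightarrow> 'a::unital_star_algebra \<Rightarrow> 'm) \<Rightarrow> (('a \<Rightarrow> 'a) \<Rightarrow> 'm) \<Rightarrow>
    ('b::unital_star_algebra \<Rightarrow> 'b) set \<Rightarrow> (('b \<Rightarrow> 'b) \<Rightarrow> ('a \<Rightarrow> 'a)) \<Rightarrow> 'm set" where
  "M_Psi act vphi g' \<psi> = submodule act hull ((vphi \<circ> \<psi>) ` g')"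

definition orth_complement ::
  "('m \<Rightarrow> 'm \<Rightarrow> 'a::unital_star_algebra) \<Rightarrow> 'm set \<Rightarrow> 'm set" where
  "orth_complement h N = {m. \<forall>n\<in>N. h m n = 0}"

text \<open>The map \<open>psihat\<close> is only constrained on $M_\Psi$.\<close>

locale real_calculus_hom =
  dom: real_calculus act g vphi + cod: real_calculus act' g' vphi'
  for act :: "'m::ab_group_add \<Rightarrow> 'a::unital_star_algebra \<Rightarrow> 'm" and g vphi
    and act' :: "'n::ab_group_add \<Rightarrow> 'b::unital_star_algebra \<Rightarrow> 'n" and g' vphi' +
  fixes \<phi> :: "'a \<Rightarrow> 'b"
    and \<psi> :: "('b \<Rightarrow> 'b) \<Rightarrow> ('a \<Rightarrow> 'a)"
    and psihat :: "'m \<Rightarrow> 'n"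
  assumes \<phi>_hom: "star_algebra_hom \<phi>"
    and \<psi>_hom: "lie_algebra_hom_on g' g \<psi>"
    and \<phi>_\<psi>: "\<delta> \<in> g' \<Longrightarrow> \<delta> (\<phi> a) = \<phi> (\<psi> \<delta> a)"
    and psihat_add: "m \<in> M_Psi act vphi g' \<psi> \<Longrightarrow> n \<in> M_Psi act vphi g' \<psi> \<Longrightarrow>
      psihat (m + n) = psihat m + psihat n"
    and psihat_act: "m \<in> M_Psi act vphi g' \<psi> \<Longrightarrow> psihat (act m a) = act' (psihat m) (\<phi> a)"
    and psihat_vphi: "\<delta> \<in> g' \<Longrightarrow> psihat (vphi (\<psi> \<delta>)) = vphi' \<delta>"

locale isometric_embedding =
  real_calculus_hom act g vphi act' g' vphi' \<phi> \<psi> psihat +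
  dom: real_metric_calculus act g vphi h + cod: real_metric_calculus act' g' vphi' h'
  for act :: "'m::ab_group_add \<Rightarrow> 'a::unital_star_algebra \<Rightarrow> 'm" and g vphi h
    and act' :: "'n::ab_group_add \<Rightarrow> 'b::unital_star_algebra \<Rightarrow> 'n" and g' vphi' h'
    and \<phi> \<psi> psihat +
  assumes isometric: "\<delta>1 \<in> g' \<Longrightarrow> \<delta>2 \<in> g' \<Longrightarrow>
      h' (vphi' \<delta>1) (vphi' \<delta>2) = \<phi> (h (vphi (\<psi> \<delta>1)) (vphi (\<psi> \<delta>2)))"
    and \<phi>_surj: "surj \<phi>"
    and decomposition:
      "direct_sum (M_Psi act vphi g' \<psi>) (orth_complement h (M_Psi act vphi g' \<psi>))"

definition second_fundamental_form ::
  "('m::ab_group_add \<Rightarrow> 'a::unital_star_algebra \<Rightarrow> 'm) \<Rightarrow> (('a \<Rightarrow> 'a) \<Rightarrow> 'm) \<Rightarrow>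
    ('m \<Rightarrow> 'm \<Rightarrow> 'a) \<Rightarrow> (('a \<Rightarrow> 'a) \<Rightarrow> 'm \<Rightarrow> 'm) \<Rightarrow>
    ('b::unital_star_algebra \<Rightarrow> 'b) set \<Rightarrow> (('b \<Rightarrow> 'b) \<Rightarrow> ('a \<Rightarrow> 'a)) \<Rightarrow>
    ('b \<Rightarrow> 'b) \<Rightarrow> 'm \<Rightarrow> 'm" where
  "second_fundamental_form act vphi h nabla g' \<psi> \<delta> m =
    projection (orth_complement h (M_Psi act vphi g' \<psi>)) (M_Psi act vphi g' \<psi>)
      (nabla (\<psi> \<delta>) m)"

definition weingarten_map ::
  "('m::ab_group_add \<Rightarrow> 'a::unital_star_algebra \<Rightarrow> 'm) \<Rightarrow> (('a \<Rightarrow> 'a) \<Rightarrow> 'm) \<Rightarrow>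
    ('m \<Rightarrow> 'm \<Rightarrow> 'a) \<Rightarrow> (('a \<Rightarrow> 'a) \<Rightarrow> 'm \<Rightarrow> 'm) \<Rightarrow>
    ('b::unital_star_algebra \<Rightarrow> 'b) set \<Rightarrow> (('b \<Rightarrow> 'b) \<Rightarrow> ('a \<Rightarrow> 'a)) \<Rightarrow>
    'm \<Rightarrow> ('b \<Rightarrow> 'b) \<Rightarrow> 'm" where
  "weingarten_map act vphi h nabla g' \<psi> \<xi> \<delta> =
    - projection (M_Psi act vphi g' \<psi>) (orth_complement h (M_Psi act vphi g' \<psi>))
      (nabla (\<psi> \<delta>) \<xi>)"

end

theory Submission
  imports Defs
begin

text \<open>Since \<open>m\<close> and \<open>\<xi>\<close> are orthogonal, differentiating \<open>h \<xi> m = 0\<close> along \<open>\<psi> \<delta>\<close> gives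
  \<open>h (\<nabla> \<xi>) m + h \<xi> (\<nabla> m) = 0\<close>; pairing with \<open>m\<close> only sees the component of \<open>\<nabla> \<xi>\<close> in
  $M_\Psi$, and pairing with \<open>\<xi>\<close> only sees the component of \<open>\<nabla> m\<close> in the complement.\<close>

lemma direct_sum_commute: "direct_sum U V \<longleftrightarrow> direct_sum V U"
  unfolding direct_sum_def by (metis add.commute inf_commute)

text \<open>This discharges the definite description in \<open>projection\<close>: two candidates
  for the \<open>U\<close>-component differ by an element of \<open>U \<inter> V\<close>, which is
  zero. Closure under differences is all the structure that this argument needs.\<close>

lemma projection_eqI:
  assumes "direct_sum U V"
    and U: "\<And>x y. x \<in> U \<Longrightarrow> y \<in> U \<Longrightarrow> x - y \<in> U"
    and V: "\<And>x y. x \<in> V \<Longrightarrow> y \<in> V \<Longrightarrow> x - y \<in> V"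
    and "u \<in> U" "v \<in> V"
  shows "projection U V (u + v) = u"
  unfolding projection_def
proof (rule the_equality)
  fix u' assume "u' \<in> U \<and> (\<exists>v'\<in>V. u + v = u' + v')"
  then obtain v' where u': "u' \<in> U" and v': "v' \<in> V" and eq: "u + v = u' + v'"
    by blast
  have "u' - u = v - v'"
    using eq by (simp add: algebra_simps)
  then have "u' - u \<in> U \<inter> V"
    using U[OF u' \<open>u \<in> U\<close>] V[OF \<open>v \<in> V\<close> v'] by simp
  then have "u' - u = 0"
    using \<open>direct_sum U V\<close> unfolding direct_sum_def by blast
  then show "u' = u"
    by simp
qed (use assms in blast)

lemma direct_sum_projections:
  assumes "direct_sum U V"
    and "\<And>x y. x \<in> U \<Longrightarrow> y \<in> U \<Longrightarrow> x - y \<in> U"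
    and "\<And>x y. x \<in> V \<Longrightarrow> y \<in> V \<Longrightarrow> x - y \<in> V"
  shows "projection U V m \<in> U" "projection V U m \<in> V"
    "projection U V m + projection V U m = m"
proof -
  obtain u v where uv: "u \<in> U" "v \<in> V" "m = u + v"
    using assms(1) unfolding direct_sum_def by blast
  have "projection U V m = u"
    using uv assms by (simp add: projection_eqI)
  moreover have "projection V U m = v"
    \<comment> \<open>The same uniqueness result with \<open>U\<close> and \<open>V\<close>
      exchanged, applied to \<open>v + u\<close>.\<close>
    using uv assms by (simp add: add.commute[of u] direct_sum_commute[of U] projection_eqI)
  ultimately show "projection U V m \<in> U" "projection V U m \<in> V"
    "projection U V m + projection V U m = m"
    using uv by simp_all
qed

lemma orth_complementD: "m \<in> orth_complement h N \<Longrightarrow> n \<in> N \<Longrightarrow> h m n = 0"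
  by (simp add: orth_complement_def)

text \<open>Submodules are stable under arbitrary intersections, so the hull is itself one.\<close>

lemma submodule_M_Psi: "submodule act (M_Psi act vphi g' \<psi>)"
  unfolding M_Psi_def by (rule hull_in) (auto simp: submodule_def)

text \<open>Closure under negation is not a clause of \<open>submodule\<close>; it comes from the
  action of the scalar \<open>- 1\<close>.\<close>

lemma (in right_module) act_minus_one: "m \<odot> (- 1) = - m"
proof -
  have "m \<odot> 0 = 0"
    using act_add_right[of m 0 0] by simp
  then have "m \<odot> (- 1) + m = 0"
    using act_add_right[of m "- 1" 1] by (simp add: act_one)
  then show ?thesis
    by (simp add: eq_neg_iff_add_eq_0)
qed

lemma (in right_module) submodule_diff:
  assumes "submodule (\<odot>) N" "m \<in> N" "n \<in> N"
  shows "m - n \<in> N"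
proof -
  have "m + n \<odot> (- 1) \<in> N"
    using assms by (simp add: submodule_def)
  then show ?thesis
    by (simp add: act_minus_one)
qed

context real_metric_calculus
begin

text \<open>Hermitian symmetry carries additivity over from the second argument, since
  \<open>star\<close> is additive.\<close>

lemma h_add_left: "h (m + n) p = h m p + h n p"
  using h_star[of "m + n" p] h_star[of m p] h_star[of n p] by (simp add: h_add star_add)

lemma h_minus_left: "h (- m) p = - h m p"
proof -
  have "h 0 p = 0"
    using h_add_left[of 0 0 p] by simp
  then have "h (- m) p + h m p = 0"
    using h_add_left[of "- m" m p] by simp
  then show ?thesis
    by (simp add: eq_neg_iff_add_eq_0)
qed

lemma orth_complement_diff:
  "m \<in> orth_complement h N \<Longrightarrow> n \<in> orth_complement h N \<Longrightarrow> m - n \<in> orth_complement h N"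
  using h_add_left[of m "- n"] by (simp add: orth_complement_def h_minus_left)

end

theorem proposition4p5:
  fixes act :: "'m::ab_group_add \<Rightarrow> 'a::unital_star_algebra \<Rightarrow> 'm"
    and act' :: "'n::ab_group_add \<Rightarrow> 'b::unital_star_algebra \<Rightarrow> 'n"
    and \<phi> :: "'a \<Rightarrow> 'b"
    and \<psi> :: "('b \<Rightarrow> 'b) \<Rightarrow> ('a \<Rightarrow> 'a)"
    and psihat :: "'m \<Rightarrow> 'n"
  assumes "pseudo_riemannian_calculus act g vphi h nabla"
    and "pseudo_riemannian_calculus act' g' vphi' h' nabla'"
    and "isometric_embedding act g vphi h act' g' vphi' h' \<phi> \<psi> psihat"
    and "\<delta> \<in> g'"
    and "m \<in> M_Psi act vphi g' \<psi>"
    and "\<xi> \<in> orth_complement h (M_Psi act vphi g' \<psi>)"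
  shows "h (weingarten_map act vphi h nabla g' \<psi> \<xi> \<delta>) m
       = h \<xi> (second_fundamental_form act vphi h nabla g' \<psi> \<delta> m)"
proof -
  interpret pseudo_riemannian_calculus act g vphi h nabla by fact
  interpret emb: isometric_embedding act g vphi h act' g' vphi' h' \<phi> \<psi> psihat by fact
  let ?N = "M_Psi act vphi g' \<psi>"
  let ?C = "orth_complement h ?N"
  have \<psi>\<delta>: "\<psi> \<delta> \<in> g"
    using emb.\<psi>_hom \<open>\<delta> \<in> g'\<close> by (simp add: lie_algebra_hom_on_def)
  \<comment> \<open>For any vector, \<open>proj(1)\<close> places its tangential part in
    \<open>?N\<close>, \<open>proj(2)\<close> its normal part in \<open>?C\<close>, and
    \<open>proj(3)\<close> adds the two up.\<close>
  note proj = direct_sum_projections[OF emb.decomposition submodule_diff[OF submodule_M_Psi]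
      orth_complement_diff]
  have "h (nabla (\<psi> \<delta>) \<xi>) m
      = h (projection ?N ?C (nabla (\<psi> \<delta>) \<xi>)) m + h (projection ?C ?N (nabla (\<psi> \<delta>) \<xi>)) m"
    using proj(3)[of "nabla (\<psi> \<delta>) \<xi>"] by (simp flip: h_add_left)
  then have tangential: "h (nabla (\<psi> \<delta>) \<xi>) m = h (projection ?N ?C (nabla (\<psi> \<delta>) \<xi>)) m"
    using orth_complementD[OF proj(2) assms(5)] by simp
  have "h \<xi> (nabla (\<psi> \<delta>) m)
      = h \<xi> (projection ?N ?C (nabla (\<psi> \<delta>) m)) + h \<xi> (projection ?C ?N (nabla (\<psi> \<delta>) m))"
    using proj(3)[of "nabla (\<psi> \<delta>) m"] by (simp flip: h_add)
  then have normal: "h \<xi> (nabla (\<psi> \<delta>) m) = h \<xi> (projection ?C ?N (nabla (\<psi> \<delta>) m))"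
    using orth_complementD[OF assms(6) proj(1)] by simp
  have "derivation (\<psi> \<delta>)"
    using lie_algebra \<psi>\<delta> by (simp add: derivation_lie_algebra_def)
  \<comment> \<open>Additivity at zero forces a derivation to send \<open>0\<close> to
    \<open>0\<close>, which is the value of \<open>h \<xi> m\<close>.\<close>
  then have "\<psi> \<delta> (0 + 0) = \<psi> \<delta> 0 + \<psi> \<delta> 0"
    unfolding derivation_def by blast
  then have "\<psi> \<delta> (h \<xi> m) = 0"
    using orth_complementD[OF assms(6,5)] by simp
  then have "h (nabla (\<psi> \<delta>) \<xi>) m + h \<xi> (nabla (\<psi> \<delta>) m) = 0"
    by (simp add: metric_compatible[OF \<psi>\<delta>])
  \<comment> \<open>The minus sign in the Weingarten map turns this vanishing sum into the required
    equality.\<close>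
  then show ?thesis
    by (simp add: weingarten_map_def second_fundamental_form_def h_minus_left tangential normal
        neg_eq_iff_add_eq_0)
qed

end
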